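(* Let $n\ge0$, let $\beta_t\in\mathbb R$, $\sigma^2_{{\bf n}_t}>0$ ($0\le t\le n-1$), $\sigma^2_{{\bf x}_0}>0$, and let $\sigma^2_{{\bf w}_t},\sigma^2_{{\bf v}_t}>0$, $b_t\in\mathbb R$, $\theta_t\in(0,\infty)$ ($0\le t\le n$) be given. Consider the encoder's optimization problem $$J^{e}_{\mathrm{average\ total}}=\min_{A_t\ge0,\ t=0,\dots,n}\ \frac{1}{n+1}\sum_{t=0}^n\left[\frac{\Sigma^*_{t|t-1}\sigma^2_{{\bf w}_t}\sigma^2_{{\bf v}_t}}{(A_t^2\sigma^2_{{\bf w}_t}+\sigma^2_{{\bf v}_t})\Sigma^*_{t|t-1}+\sigma^2_{{\bf w}_t}\sigma^2_{{\bf v}_t}}+\theta_tA_t^2\Sigma^*_{t|t-1}+b_t^2\right],\qquad \Sigma^*_{0|-1}=\sigma^2_{{\bf x}_0},$$ solved myopically, stage by stage forward in time (see context). Its solution is $$J^{e,*}_{\mathrm{average\ total}}=\frac{1}{n+1}\sum_{t=0}^nJ_t^{e,*},$$ where, forward in time, $$J_t^{e,*}=J_t^{d,*}+\theta_tA_t^{2,*}\Sigma^*_{t|t-1}+b_t^2,\qquad J_t^{d,*}=\frac{\Sigma^*_{t|t-1}\sigma^2_{{\bf w}_t}\sigma^2_{{\bf v}_t}}{(A_t^{2,*}\sigma^2_{{\bf w}_t}+\sigma^2_{{\bf v}_t})\Sigma^*_{t|t-1}+\sigma^2_{{\bf w}_t}\sigma^2_{{\bf v}_t}},$$ the optimal squared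 gains $A_t^{2,*}$ are $$A_t^{2,*}=\begin{cases}\dfrac{\sigma^2_{{\bf v}_t}}{\sqrt{\theta_t\Sigma^*_{t|t-1}\sigma^2_{{\bf v}_t}}}-\dfrac{\sigma^2_{{\bf v}_t}}{\Sigma^*_{t|t-1}}\left(\dfrac{\Sigma^*_{t|t-1}}{\sigma^2_{{\bf w}_t}}+1\right), & \text{if } \theta_t<\dfrac{\Sigma^*_{t|t-1}}{\sigma^2_{{\bf v}_t}\left(\frac{\Sigma^*_{t|t-1}}{\sigma^2_{{\bf w}_t}}+1\right)^2},\\[3ex] 0, & \text{if } \theta_t\ge\dfrac{\Sigma^*_{t|t-1}}{\sigma^2_{{\bf v}_t}\left(\frac{\Sigma^*_{t|t-1}}{\sigma^2_{{\bf w}_t}}+1\right)^2},\end{cases}$$ and $$\Sigma^*_{t|t-1}=\beta_{t-1}^2J_{t-1}^{d,*}+\sigma^2_{{\bf n}_{t-1}},\qquad t=1,\dots,n.$$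
   Context: Origin of the problem: a Gauss–Markov source ${\bf x}_{t+1}=\beta_t{\bf x}_t+{\bf n}_t$ is sent by an encoder using the linear innovations strategy ${\bf m}_t=A_t({\bf x}_t-{\bf E}[{\bf x}_t|{\bf r}^{t-1}])$ to a decoder that receives ${\bf r}_t=\alpha_t({\bf m}_t+{\bf v}_t)+(1-\alpha_t)({\bf x}_t+{\bf w}_t)$ with optimally chosen $\alpha_t\in[0,1]$ (all noises independent zero-mean Gaussian with the indicated variances). The stage-$t$ decoder cost is the mean-square estimation error of ${\bf x}_t$, and the stage-$t$ encoder cost is that error plus $\theta_t{\bf E}[{\bf m}_t^2]+b_t^2$. $\Sigma^*_{t|t-1}$ is the one-step prediction error variance of ${\bf x}_t$. Myopic, forward-in-time solution: encoder and decoder are myopic. At stage $t=0,1,\dots,n$ in turn, the quantity $\Sigma^*_{t|t-1}$ is already determined by the optimal choices at earlier stages ($\Sigma^*_{0|-1}=\sigma^2_{{\bf x}_0}$, and $\Sigma^*_{t|t-1}$ equals $\beta_{t-1}^2$ times the optimal stage-$(t-1)$ estimation error plus $\sigma^2_{{\bf n}_{t-1}}$), and $A_t\ge0$ is chosen to minimize the $t$-th summand (in square brackets), with $\Sigma^*_{t|t-1}$ treated as a constant. $A_t^{2,*}$ denotes the square of the optimal gain, $J_t^{e,*}$ the minimal value of the $t$-th summand, and $J_t^{d,*}$ the value of its first term at the optimum. *)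

theory Defs
  imports Complex_Main
begin

text \<open>
  Variances are passed as such (not as standard deviations): \<open>vw\<close>, \<open>vv\<close>, \<open>vn\<close>, \<open>vx\<close> stand for
  the variances of \<open>w\<^sub>t\<close>, \<open>v\<^sub>t\<close>, \<open>n\<^sub>t\<close> and \<open>x\<^sub>0\<close>, and \<open>s\<close>, \<open>S t\<close> for the one-step prediction error
  variance of \<open>x\<^sub>t\<close> given the observations up to time \<open>t - 1\<close>. The argument \<open>a\<close> is the gain itself,
  not its square.
\<close>

definition decoder_cost :: "real \<Rightarrow> real \<Rightarrow> real \<Rightarrow> real \<Rightarrow> real" where
  "decoder_cost vw vv s a = (s * vw * vv) / ((a\<^sup>2 * vw + vv) * s + vw * vv)"

definition encoder_cost :: "real \<Rightarrow> real \<Rightarrow> real \<Rightarrow> real \<Rightarrow> real \<Rightarrow> real \<Rightarrow> real" where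
  "encoder_cost vw vv \<theta> b s a = decoder_cost vw vv s a + \<theta> * a\<^sup>2 * s + b\<^sup>2"

definition average_cost ::
  "nat \<Rightarrow> (nat \<Rightarrow> real) \<Rightarrow> (nat \<Rightarrow> real) \<Rightarrow> (nat \<Rightarrow> real) \<Rightarrow> (nat \<Rightarrow> real)
    \<Rightarrow> (nat \<Rightarrow> real) \<Rightarrow> (nat \<Rightarrow> real) \<Rightarrow> real" where
  "average_cost n vw vv \<theta> b S A =
     1 / real (n + 1) * (\<Sum>t=0..n. encoder_cost (vw t) (vv t) (\<theta> t) (b t) (S t) (A t))"

text \<open>
  Myopic forward-in-time solution: \<open>A t\<close> minimizes the stage cost over nonnegative gains with
  \<open>S t\<close> held constant, and \<open>S (t + 1)\<close> is then determined by the estimation error \<open>Jd t\<close> achieved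
  at stage \<open>t\<close>. \<open>Je t\<close> is the minimal stage cost. Values at times beyond \<open>n\<close> are unconstrained.
\<close>

definition myopic_solution ::
  "nat \<Rightarrow> (nat \<Rightarrow> real) \<Rightarrow> (nat \<Rightarrow> real) \<Rightarrow> real \<Rightarrow> (nat \<Rightarrow> real) \<Rightarrow> (nat \<Rightarrow> real)
    \<Rightarrow> (nat \<Rightarrow> real) \<Rightarrow> (nat \<Rightarrow> real)
    \<Rightarrow> (nat \<Rightarrow> real) \<Rightarrow> (nat \<Rightarrow> real) \<Rightarrow> (nat \<Rightarrow> real) \<Rightarrow> (nat \<Rightarrow> real) \<Rightarrow> bool" where
  "myopic_solution n \<beta> vn vx vw vv \<theta> b S A Jd Je \<longleftrightarrow>
     S 0 = vx \<and>
     (\<forall>t<n. S (t + 1) = (\<beta> t)\<^sup>2 * Jd t + vn t) \<and>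
     (\<forall>t\<le>n.
        is_arg_min (encoder_cost (vw t) (vv t) (\<theta> t) (b t) (S t)) (\<lambda>a. a \<ge> 0) (A t) \<and>
        Jd t = decoder_cost (vw t) (vv t) (S t) (A t) \<and>
        Je t = encoder_cost (vw t) (vv t) (\<theta> t) (b t) (S t) (A t))"

end

theory Submission
  imports Defs
begin

text \<open>
  The stage cost becomes transparent in the variable \<open>y = p + c\<close>, where \<open>p = a\<^sup>2 * s\<close> is the
  transmit power and \<open>c = vv * (s / vw + 1)\<close> is the channel noise, inflated to account for the
  side observation through \<open>w\<close>. The estimation error is then \<open>s * vv / y\<close>, so that with
  \<open>q = sqrt (s * vv / \<theta>)\<close> the stage cost equals \<open>\<theta> * (y + q\<^sup>2 / y)\<close> up to a constant
  (lemma \<open>encoder_cost_eq_level\<close>). The function \<open>y + q\<^sup>2 / y\<close> is strictly decreasing up to \<open>q\<close>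
  and strictly increasing afterwards, and nonnegativity of the power means \<open>y \<ge> c\<close>. Its unique
  minimizer is therefore \<open>y = max c q\<close> (lemma \<open>level_cost_min\<close>): the encoder fills the level up
  to \<open>q\<close> if the noise leaves room for it and is silent otherwise. Solving
  \<open>a\<^sup>2 * s + c = max c q\<close> for \<open>a\<^sup>2\<close> gives the claimed gain, and \<open>c < q\<close> is the claimed threshold
  on \<open>\<theta>\<close> (lemmas \<open>threshold_iff\<close> and \<open>is_arg_min_encoder_cost_iff\<close>).

  All this needs a positive prediction error variance. Positivity propagates along the recursion,
  since every stage error is nonnegative and the source noise is positive (lemma
  \<open>prediction_variance_pos\<close>). The myopic condition and the closed form thus agree stage by
  stage; the latter can be run forward in time, which gives existence. Finally, with the variances
  \<open>S\<close> held constant the average cost is separable in the gains, so stagewise minimizers minimize it.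
\<close>

section \<open>The cost of a single stage\<close>

definition optimal_sq_gain :: "real \<Rightarrow> real \<Rightarrow> real \<Rightarrow> real \<Rightarrow> real" where
  "optimal_sq_gain vw vv \<theta> s =
     (if \<theta> < s / (vv * (s / vw + 1)\<^sup>2)
      then vv / sqrt (\<theta> * s * vv) - vv / s * (s / vw + 1)
      else 0)"

text \<open>The total level \<open>y\<close> on the decoder side: transmit power plus inflated channel noise.\<close>

definition signal_level :: "real \<Rightarrow> real \<Rightarrow> real \<Rightarrow> real \<Rightarrow> real" where
  "signal_level vw vv s a = a\<^sup>2 * s + vv * (s / vw + 1)"

text \<open>
  Both bounds come from the factorization of the cost difference between the levels \<open>y\<close> and
  \<open>m = max c q\<close> as \<open>(y - m) * (1 - q\<^sup>2 / (y * m))\<close>. If \<open>m = q\<close>, this is \<open>(y - q)\<^sup>2 / y\<close>; if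
  \<open>m = c\<close>, both factors are nonnegative because \<open>q \<le> c \<le> y\<close>.
\<close>

lemma level_cost_min:
  fixes c q y :: real
  assumes "c > 0" "q > 0" "y \<ge> c"
  shows "max c q + q\<^sup>2 / max c q \<le> y + q\<^sup>2 / y"
    and "y \<noteq> max c q \<Longrightarrow> max c q + q\<^sup>2 / max c q < y + q\<^sup>2 / y"
proof -
  define m where "m = max c q"
  have pos: "m > 0" "y > 0" using assms by (auto simp: m_def)
  have diff: "(y + q\<^sup>2 / y) - (m + q\<^sup>2 / m) = (y - m) * (y * m - q\<^sup>2) / (y * m)"
    using pos by (simp add: field_simps power2_eq_square)
  have *: "0 < (y - m) * (y * m - q\<^sup>2)" if "y \<noteq> m"
  proof (cases "c < q")
    case True
    then have "(y - m) * (y * m - q\<^sup>2) = (y - m)\<^sup>2 * q"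
      by (simp add: m_def algebra_simps power2_eq_square)
    then show ?thesis using assms that by simp
  next
    case False
    then have m: "m = c" "q \<le> c" by (auto simp: m_def)
    then have "y > c" using assms that by simp
    have "q\<^sup>2 \<le> c * c" using m assms by (simp add: power2_eq_square mult_mono)
    also have "\<dots> < y * c" using \<open>y > c\<close> assms by simp
    finally show ?thesis using m \<open>y > c\<close> by simp
  qed
  show strict: "max c q + q\<^sup>2 / max c q < y + q\<^sup>2 / y" if "y \<noteq> max c q"
  proof -
    have "0 < (y - m) * (y * m - q\<^sup>2) / (y * m)" using * that pos by (simp add: m_def)
    then show ?thesis using diff by (simp add: m_def)
  qed
  show "max c q + q\<^sup>2 / max c q \<le> y + q\<^sup>2 / y"
    using strict by (cases "y = max c q") auto
qed

lemma decoder_cost_nonneg: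
  assumes "vw > 0" "vv > 0" "s > 0"
  shows "decoder_cost vw vv s a \<ge> 0"
  using assms by (simp add: decoder_cost_def)

lemma encoder_cost_eq_level:
  fixes vw vv \<theta> b s a :: real
  assumes "vw > 0" "vv > 0" "\<theta> > 0" "s > 0"
  defines "y \<equiv> signal_level vw vv s a"
  shows "encoder_cost vw vv \<theta> b s a =
    \<theta> * (y + (sqrt (s * vv / \<theta>))\<^sup>2 / y) + (b\<^sup>2 - \<theta> * (vv * (s / vw + 1)))"
proof -
  have "(a\<^sup>2 * vw + vv) * s + vw * vv = vw * y"
    using assms by (simp add: y_def signal_level_def field_simps)
  then have "decoder_cost vw vv s a = s * vv / y"
    using assms(1) by (simp add: decoder_cost_def)
  moreover have "(sqrt (s * vv / \<theta>))\<^sup>2 = s * vv / \<theta>"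
    using assms(2-4) by simp
  then have "\<theta> * ((sqrt (s * vv / \<theta>))\<^sup>2 / y) = s * vv / y"
    using assms(3) by simp
  moreover have "\<theta> * a\<^sup>2 * s = \<theta> * y - \<theta> * (vv * (s / vw + 1))"
    by (simp add: y_def signal_level_def algebra_simps)
  ultimately show ?thesis
    by (simp only: encoder_cost_def distrib_left)
qed

text \<open>The threshold on \<open>\<theta>\<close> says that the noise lies below the critical level: \<open>c < q\<close>, squared.\<close>

lemma threshold_iff:
  fixes vw vv \<theta> s :: real
  assumes "vw > 0" "vv > 0" "\<theta> > 0" "s > 0"
  shows "\<theta> < s / (vv * (s / vw + 1)\<^sup>2) \<longleftrightarrow> vv * (s / vw + 1) < sqrt (s * vv / \<theta>)"
proof -
  define k where "k = s / vw + 1"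
  have k: "k > 0" using assms by (simp add: k_def add_pos_pos)
  have "vv * k < sqrt (s * vv / \<theta>) \<longleftrightarrow> (vv * k)\<^sup>2 < s * vv / \<theta>"
    using assms k by (metis abs_of_pos mult_pos_pos real_sqrt_abs real_sqrt_less_iff)
  also have "\<dots> \<longleftrightarrow> \<theta> < s / (vv * k\<^sup>2)"
    using assms k by (simp add: field_simps power2_eq_square)
  finally show ?thesis by (simp add: k_def)
qed

text \<open>The optimal power \<open>s * A\<^sup>2\<close> is what the noise leaves to be filled up to the critical level.\<close>

lemma optimal_sq_gain_eq:
  assumes "vw > 0" "vv > 0" "\<theta> > 0" "s > 0"
  shows "optimal_sq_gain vw vv \<theta> s =
    (max (vv * (s / vw + 1)) (sqrt (s * vv / \<theta>)) - vv * (s / vw + 1)) / s"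
proof -
  have "s * vv / \<theta> = (s * vv)\<^sup>2 / (\<theta> * s * vv)"
    using assms by (simp add: field_simps power2_eq_square)
  then have "sqrt (s * vv / \<theta>) = sqrt ((s * vv)\<^sup>2) / sqrt (\<theta> * s * vv)"
    by (simp only: real_sqrt_divide)
  then have "sqrt (s * vv / \<theta>) / s = vv / sqrt (\<theta> * s * vv)"
    using assms by simp
  then show ?thesis
    unfolding optimal_sq_gain_def threshold_iff[OF assms]
    by (simp add: max_def diff_divide_distrib)
qed

lemma optimal_sq_gain_nonneg:
  assumes "vw > 0" "vv > 0" "\<theta> > 0" "s > 0"
  shows "optimal_sq_gain vw vv \<theta> s \<ge> 0"
  unfolding optimal_sq_gain_eq[OF assms] using assms(4) by simp

lemma sq_eq_optimal_sq_gain_iff: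
  assumes "vw > 0" "vv > 0" "\<theta> > 0" "s > 0"
  shows "a\<^sup>2 = optimal_sq_gain vw vv \<theta> s \<longleftrightarrow>
    signal_level vw vv s a = max (vv * (s / vw + 1)) (sqrt (s * vv / \<theta>))"
  unfolding optimal_sq_gain_eq[OF assms] signal_level_def eq_divide_eq
  using assms(4) by auto

lemma is_arg_min_encoder_cost_iff:
  assumes "vw > 0" "vv > 0" "\<theta> > 0" "s > 0"
  shows "is_arg_min (encoder_cost vw vv \<theta> b s) (\<lambda>a. a \<ge> 0) a \<longleftrightarrow>
    a \<ge> 0 \<and> a\<^sup>2 = optimal_sq_gain vw vv \<theta> s"
proof -
  define m where "m = max (vv * (s / vw + 1)) (sqrt (s * vv / \<theta>))"
  let ?cost = "encoder_cost vw vv \<theta> b s"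
  let ?y = "signal_level vw vv s"
  let ?h = "\<lambda>y. y + (sqrt (s * vv / \<theta>))\<^sup>2 / y"
  have noise_pos: "vv * (s / vw + 1) > 0"
    using assms by (simp add: add_pos_pos)
  have critical_pos: "sqrt (s * vv / \<theta>) > 0"
    using assms by simp
  have level_ge: "?y x \<ge> vv * (s / vw + 1)" for x
    using assms by (simp add: signal_level_def)
  have le: "?h m \<le> ?h (?y x)" for x
    using level_cost_min(1)[OF noise_pos critical_pos level_ge] by (simp only: m_def)
  have less: "?h m < ?h (?y x)" if "?y x \<noteq> m" for x
    using level_cost_min(2)[OF noise_pos critical_pos level_ge] that by (simp only: m_def)
  have cost_less_iff: "?cost x < ?cost x' \<longleftrightarrow> ?h (?y x) < ?h (?y x')" for x x'
    unfolding encoder_cost_eq_level[OF assms] using assms(3) by simp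
  have sq_iff: "x\<^sup>2 = optimal_sq_gain vw vv \<theta> s \<longleftrightarrow> ?y x = m" for x
    unfolding m_def by (rule sq_eq_optimal_sq_gain_iff[OF assms])
  define a0 where "a0 = sqrt (optimal_sq_gain vw vv \<theta> s)"
  have a0: "a0 \<ge> 0" "?y a0 = m"
    using optimal_sq_gain_nonneg[OF assms] by (simp_all add: a0_def flip: sq_iff)
  show ?thesis
  proof
    assume min: "is_arg_min ?cost (\<lambda>a. a \<ge> 0) a"
    then have "\<not> ?cost a0 < ?cost a" using a0(1) by (simp add: is_arg_min_def)
    then have "?y a = m" using less[of a] a0(2) by (auto simp: cost_less_iff)
    with min show "a \<ge> 0 \<and> a\<^sup>2 = optimal_sq_gain vw vv \<theta> s"
      by (simp add: is_arg_min_def sq_iff)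
  next
    assume "a \<ge> 0 \<and> a\<^sup>2 = optimal_sq_gain vw vv \<theta> s"
    then have "a \<ge> 0" "?y a = m" by (simp_all add: sq_iff)
    then show "is_arg_min ?cost (\<lambda>a. a \<ge> 0) a"
      unfolding is_arg_min_def cost_less_iff using le by (simp add: not_less)
  qed
qed

section \<open>The recursion over the stages\<close>

lemma prediction_variance_pos:
  fixes n t :: nat
  assumes "\<And>t. t < n \<Longrightarrow> vn t > 0" "vx > 0"
    and "\<And>t. t \<le> n \<Longrightarrow> vw t > 0" "\<And>t. t \<le> n \<Longrightarrow> vv t > 0"
    and "S 0 = vx" "\<And>t. t < n \<Longrightarrow> S (t + 1) = (\<beta> t)\<^sup>2 * Jd t + vn t"
    and "\<And>t. t \<le> n \<Longrightarrow> Jd t = decoder_cost (vw t) (vv t) (S t) (A t)"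
    and "t \<le> n"
  shows "S t > 0"
  using \<open>t \<le> n\<close>
proof (induction t)
  case 0
  then show ?case using assms(2,5) by simp
next
  case (Suc t)
  then have "Jd t \<ge> 0"
    using assms(3,4,7) by (simp add: decoder_cost_nonneg)
  then show ?case
    using assms(1,6)[of t] Suc.prems by (simp add: add_nonneg_pos)
qed

primrec optimal_variance ::
  "(nat \<Rightarrow> real) \<Rightarrow> (nat \<Rightarrow> real) \<Rightarrow> real \<Rightarrow> (nat \<Rightarrow> real) \<Rightarrow> (nat \<Rightarrow> real) \<Rightarrow> (nat \<Rightarrow> real)
    \<Rightarrow> nat \<Rightarrow> real" where
  "optimal_variance \<beta> vn vx vw vv \<theta> 0 = vx"
| "optimal_variance \<beta> vn vx vw vv \<theta> (Suc t) =
     (let s = optimal_variance \<beta> vn vx vw vv \<theta> t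
      in (\<beta> t)\<^sup>2 * decoder_cost (vw t) (vv t) s (sqrt (optimal_sq_gain (vw t) (vv t) (\<theta> t) s))
         + vn t)"

lemma myopic_solution_exists:
  assumes "\<And>t. t < n \<Longrightarrow> vn t > 0" "vx > 0"
    and "\<And>t. t \<le> n \<Longrightarrow> vw t > 0" "\<And>t. t \<le> n \<Longrightarrow> vv t > 0" "\<And>t. t \<le> n \<Longrightarrow> \<theta> t > 0"
  shows "\<exists>S A Jd Je. myopic_solution n \<beta> vn vx vw vv \<theta> b S A Jd Je"
proof -
  define S where "S = optimal_variance \<beta> vn vx vw vv \<theta>"
  define A where "A = (\<lambda>t. sqrt (optimal_sq_gain (vw t) (vv t) (\<theta> t) (S t)))"
  define Jd where "Jd = (\<lambda>t. decoder_cost (vw t) (vv t) (S t) (A t))"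
  have S0: "S 0 = vx"
    by (simp add: S_def)
  have S_Suc: "S (t + 1) = (\<beta> t)\<^sup>2 * Jd t + vn t" for t
    by (simp add: S_def A_def Jd_def Let_def)
  have "S t > 0" if "t \<le> n" for t
    by (rule prediction_variance_pos[where Jd = Jd and A = A and S = S])
       (use assms S0 S_Suc that in \<open>auto simp: Jd_def\<close>)
  then have "is_arg_min (encoder_cost (vw t) (vv t) (\<theta> t) (b t) (S t)) (\<lambda>a. a \<ge> 0) (A t)"
    if "t \<le> n" for t
    using assms(3-5) that
    by (simp add: is_arg_min_encoder_cost_iff A_def optimal_sq_gain_nonneg)
  then have "myopic_solution n \<beta> vn vx vw vv \<theta> b S A Jd
      (\<lambda>t. encoder_cost (vw t) (vv t) (\<theta> t) (b t) (S t) (A t))"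
    using S0 S_Suc by (simp add: myopic_solution_def Jd_def)
  then show ?thesis by blast
qed

lemma myopic_solution_iff:
  assumes "\<And>t. t < n \<Longrightarrow> vn t > 0" "vx > 0"
    and "\<And>t. t \<le> n \<Longrightarrow> vw t > 0" "\<And>t. t \<le> n \<Longrightarrow> vv t > 0" "\<And>t. t \<le> n \<Longrightarrow> \<theta> t > 0"
  shows "myopic_solution n \<beta> vn vx vw vv \<theta> b S A Jd Je \<longleftrightarrow>
    S 0 = vx \<and>
    (\<forall>t\<in>{1..n}. S t = (\<beta> (t - 1))\<^sup>2 * Jd (t - 1) + vn (t - 1)) \<and>
    (\<forall>t\<le>n. A t \<ge> 0 \<and> (A t)\<^sup>2 = optimal_sq_gain (vw t) (vv t) (\<theta> t) (S t) \<and>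
       Jd t = decoder_cost (vw t) (vv t) (S t) (A t) \<and>
       Je t = Jd t + \<theta> t * (A t)\<^sup>2 * S t + (b t)\<^sup>2)"
    (is "_ \<longleftrightarrow> ?init \<and> ?step' \<and> ?closed")
proof -
  let ?step = "\<forall>t<n. S (t + 1) = (\<beta> t)\<^sup>2 * Jd t + vn t"
  let ?err = "\<forall>t\<le>n. Jd t = decoder_cost (vw t) (vv t) (S t) (A t)"
  have step_iff: "?step' \<longleftrightarrow> ?step"
  proof
    assume R: ?step'
    show ?step
    proof (intro allI impI)
      fix t assume "t < n"
      then show "S (t + 1) = (\<beta> t)\<^sup>2 * Jd t + vn t" using R[rule_format, of "t + 1"] by simp
    qed
  next
    assume L: ?step
    show ?step'
    proof
      fix t assume "t \<in> {1..n}"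
      then show "S t = (\<beta> (t - 1))\<^sup>2 * Jd (t - 1) + vn (t - 1)"
        using L by (cases t) auto
    qed
  qed
  \<comment> \<open>The parts common to both sides already make every \<open>S t\<close> positive.\<close>
  have pos: "S t > 0" if "?init" "?step" "?err" "t \<le> n" for t
    by (rule prediction_variance_pos[where Jd = Jd and A = A and S = S])
       (use assms that in auto)
  have stage: "is_arg_min (encoder_cost (vw t) (vv t) (\<theta> t) (b t) (S t)) (\<lambda>a. a \<ge> 0) (A t) \<longleftrightarrow>
      A t \<ge> 0 \<and> (A t)\<^sup>2 = optimal_sq_gain (vw t) (vv t) (\<theta> t) (S t)"
    if "?init" "?step" "?err" "t \<le> n" for t
    using is_arg_min_encoder_cost_iff[OF assms(3-5) pos] that by blast
  show ?thesis
    unfolding step_iff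
  proof
    assume L: "myopic_solution n \<beta> vn vx vw vv \<theta> b S A Jd Je"
    then have c: "?init" "?step" "?err" by (auto simp: myopic_solution_def)
    then show "?init \<and> ?step \<and> ?closed"
      using L stage[OF c] by (auto simp: myopic_solution_def encoder_cost_def)
  next
    assume R: "?init \<and> ?step \<and> ?closed"
    then have c: "?init" "?step" "?err" by auto
    then show "myopic_solution n \<beta> vn vx vw vv \<theta> b S A Jd Je"
      using R stage[OF c] by (auto simp: myopic_solution_def encoder_cost_def)
  qed
qed

lemma average_cost_myopic:
  assumes "myopic_solution n \<beta> vn vx vw vv \<theta> b S A Jd Je"
  shows "is_arg_min (average_cost n vw vv \<theta> b S) (\<lambda>a. \<forall>t\<le>n. a t \<ge> 0) A"
    and "average_cost n vw vv \<theta> b S A = 1 / real (n + 1) * (\<Sum>t=0..n. Je t)"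
proof -
  have min: "is_arg_min (encoder_cost (vw t) (vv t) (\<theta> t) (b t) (S t)) (\<lambda>a. a \<ge> 0) (A t)"
    if "t \<le> n" for t
    using assms that by (simp add: myopic_solution_def)
  have "average_cost n vw vv \<theta> b S A \<le> average_cost n vw vv \<theta> b S a"
    if "\<forall>t\<le>n. a t \<ge> 0" for a
    unfolding average_cost_def
    by (intro mult_left_mono sum_mono) (use min that in \<open>auto simp: is_arg_min_linorder\<close>)
  moreover have "\<forall>t\<le>n. A t \<ge> 0"
    using min by (simp add: is_arg_min_def)
  ultimately show "is_arg_min (average_cost n vw vv \<theta> b S) (\<lambda>a. \<forall>t\<le>n. a t \<ge> 0) A"
    by (simp add: is_arg_min_linorder)
  show "average_cost n vw vv \<theta> b S A = 1 / real (n + 1) * (\<Sum>t=0..n. Je t)"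
    using assms by (simp add: average_cost_def myopic_solution_def)
qed

section \<open>The myopic solution in closed form\<close>

theorem mainTheorem7:
  fixes n :: nat
    and \<beta> vn vw vv \<theta> b :: "nat \<Rightarrow> real"
    and vx :: real
  assumes "\<And>t. t < n \<Longrightarrow> vn t > 0"
    and "vx > 0"
    and "\<And>t. t \<le> n \<Longrightarrow> vw t > 0"
    and "\<And>t. t \<le> n \<Longrightarrow> vv t > 0"
    and "\<And>t. t \<le> n \<Longrightarrow> \<theta> t > 0"
  shows
    "(\<exists>S A Jd Je. myopic_solution n \<beta> vn vx vw vv \<theta> b S A Jd Je) \<and>
     (\<forall>S A Jd Je.
        myopic_solution n \<beta> vn vx vw vv \<theta> b S A Jd Je \<longleftrightarrow>
          S 0 = vx \<and>
          (\<forall>t\<in>{1..n}. S t = (\<beta> (t - 1))\<^sup>2 * Jd (t - 1) + vn (t - 1)) \<and>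
          (\<forall>t\<le>n.
             A t \<ge> 0 \<and>
             (A t)\<^sup>2 =
               (if \<theta> t < S t / (vv t * (S t / vw t + 1)\<^sup>2)
                then vv t / sqrt (\<theta> t * S t * vv t) - vv t / S t * (S t / vw t + 1)
                else 0) \<and>
             Jd t = (S t * vw t * vv t) / (((A t)\<^sup>2 * vw t + vv t) * S t + vw t * vv t) \<and>
             Je t = Jd t + \<theta> t * (A t)\<^sup>2 * S t + (b t)\<^sup>2)) \<and>
     (\<forall>S A Jd Je.
        myopic_solution n \<beta> vn vx vw vv \<theta> b S A Jd Je \<longrightarrow>
          is_arg_min (average_cost n vw vv \<theta> b S) (\<lambda>a. \<forall>t\<le>n. a t \<ge> 0) A \<and>
          average_cost n vw vv \<theta> b S A = 1 / real (n + 1) * (\<Sum>t=0..n. Je t))"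
proof (intro conjI allI impI)
  show "\<exists>S A Jd Je. myopic_solution n \<beta> vn vx vw vv \<theta> b S A Jd Je"
    using assms by (rule myopic_solution_exists)
qed (rule myopic_solution_iff[OF assms, unfolded optimal_sq_gain_def decoder_cost_def],
     assumption+, (erule average_cost_myopic)+)

end
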